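(* For all integers $n\ge 0$, $$F_{n+1}^2=T_n+\sum_{k=2}^n\sum_{j=1}^{\lfloor k/2\rfloor}(2+\delta_{j,1})F^2_{k-2j+1}T_{n-k},$$ where $T_n$ is the number of ways to tile an $n$-board using half-squares and $(\frac12,\frac12)$-fences such that no even-length metatiles occur.
   Context: The Fibonacci numbers are $F_0=0$, $F_1=1$, $F_n=F_{n-1}+F_{n-2}$ for $n\ge2$. $\delta_{i,j}$ is $1$ if $i=j$ and $0$ otherwise. Empty sums are $0$. An $n$-board is a $1\times n$ array of $n$ unit square cells in a row (horizontal extent $[0,n]$). A half-square is a tile of width $\frac12$ and height $1$, covering a horizontal interval $[x,x+\frac12]$. A $(\frac12,\frac12)$-fence is a single tile composed of two pieces (posts), each of width $\frac12$ and height $1$, separated by a gap of width $\frac12$; it covers $[x,x+\frac12]\cup[x+1,x+\frac32]$ for some $x$. Tiles are not rotated. Tiles need not be aligned with the cell boundaries, and the gap of a fence must be covered by other tiles. A tiling covers the board exactly, with no overlaps (of interiors), no uncovered region and nothing protruding from the board. There is exactly one (empty) tiling of the $0$-board. A metatile is a minimal (nonempty) arrangement of tiles that exactly covers an integral number of adjacent cells, that number being its length; every tiling of a board is uniquely a concatenation of metatiles. The numbers $T_n$ satisfy $T_0=T_1=T_2=1$ and $T_n=T_{n-1}+T_{n-2}+T_{n-3}$ for $n\ge3$. *)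

theory Defs
  imports "HOL-Analysis.Analysis" "HOL-Number_Theory.Fib"
begin

(* Boards and tiles all have height 1 and occupy the same row, so a region is
   represented by its horizontal extent, a subset of the real line.  The argument of
   each tile is the coordinate of its left edge, an arbitrary real number. *)

datatype tile = Half_Square real | Fence real

fun region :: "tile \<Rightarrow> real set" where
  "region (Half_Square x) = {x..x + 1/2}"
| "region (Fence x) = {x..x + 1/2} \<union> {x + 1..x + 3/2}"

(* The m adjacent unit cells starting at a.  As a union of m cells this is empty for
   m = 0, unlike the degenerate interval {a..a}; so the 0-board has the empty tiling. *)
definition cells :: "nat \<Rightarrow> nat \<Rightarrow> real set" where
  "cells a m = (\<Union>i<m. {real (a + i)..real (a + i) + 1})"

definition board :: "nat \<Rightarrow> real set" where
  "board n = cells 0 n"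

definition exactly_covers :: "tile set \<Rightarrow> real set \<Rightarrow> bool" where
  "exactly_covers A S \<longleftrightarrow>
     finite A \<and>
     (\<forall>s\<in>A. \<forall>t\<in>A. s \<noteq> t \<longrightarrow> interior (region s) \<inter> interior (region t) = {}) \<and>
     (\<Union>t\<in>A. region t) = S"

definition tiling :: "nat \<Rightarrow> tile set \<Rightarrow> bool" where
  "tiling n A \<longleftrightarrow> exactly_covers A (board n)"

definition metatile :: "nat \<Rightarrow> tile set \<Rightarrow> bool" where
  "metatile m A \<longleftrightarrow>
     A \<noteq> {} \<and> (\<exists>a. exactly_covers A (cells a m)) \<and>
     (\<forall>B. B \<subset> A \<and> B \<noteq> {} \<longrightarrow> \<not> (\<exists>b k. exactly_covers B (cells b k)))"

definition T :: "nat \<Rightarrow> nat" where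
  "T n = card {A. tiling n A \<and> \<not> (\<exists>M m. M \<subseteq> A \<and> metatile m M \<and> even m)}"

end

theory Submission
  imports Defs
begin

text \<open>All tiles of a tiling lie on the half-integer grid, so a tiling is determined by its fences,
  and a fence at slot $i$ occupies the half-cells $i$ and $i + 2$.  Reading off, cell by cell, whether
  a fence starts in the left and in the right half turns a tiling into a word in which the metatiles
  are the blocks of nonzero letters together with their terminating zero.  Two consecutive nonzero
  letters can be deleted after a zero without changing the parity of any block, which shows that
  the numbers of words without even blocks satisfy the tribonacci recurrence.  With
  $g_k = \<Sum>_j (2 + \<delta>_{j,1}) F_{k-2j+1}^2$ one has $g_{k+2} - g_k = 3 F_{k+1}^2 - F_{k-1}^2$, hence both
  sides of the claim satisfy the same third-order recurrence.\<close>

section \<open>Half-cells and grid tiles as index sets\<close>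

definition half_cell :: "nat \<Rightarrow> real set" where
  "half_cell i = {real i / 2..real i / 2 + 1/2}"

text \<open>Regions are closed, so neighbouring half-cells share endpoints. Midpoints lie in exactly
  one half-cell and serve as test points that recover index sets from regions.\<close>

definition midpoint_of :: "nat \<Rightarrow> real" where
  "midpoint_of i = real i / 2 + 1/4"

definition half_cells :: "nat set \<Rightarrow> real set" where
  "half_cells I = (\<Union>i\<in>I. half_cell i)"

definition slots :: "tile \<Rightarrow> nat set" where
  "slots t = {i. midpoint_of i \<in> region t}"

abbreviation half_at :: "nat \<Rightarrow> tile" where
  "half_at i \<equiv> Half_Square (real i / 2)"

abbreviation fence_at :: "nat \<Rightarrow> tile" where
  "fence_at i \<equiv> Fence (real i / 2)"

definition grid :: "tile \<Rightarrow> bool" where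
  "grid t \<longleftrightarrow> (\<exists>i. t = half_at i \<or> t = fence_at i)"

fun left_edge :: "tile \<Rightarrow> real" where
  "left_edge (Half_Square x) = x"
| "left_edge (Fence x) = x"

lemma midpoint_in_half_cell [simp]: "midpoint_of i \<in> half_cell j \<longleftrightarrow> i = j"
  by (auto simp: midpoint_of_def half_cell_def)

lemma midpoint_in_half_cells [simp]: "midpoint_of i \<in> half_cells I \<longleftrightarrow> i \<in> I"
  by (auto simp: half_cells_def)

lemma half_cells_eq_iff: "half_cells I = half_cells J \<longleftrightarrow> I = J"
  by (metis midpoint_in_half_cells subsetI subset_antisym)

lemma half_cells_Union: "half_cells (\<Union>x\<in>X. f x) = (\<Union>x\<in>X. half_cells (f x))"
  by (auto simp: half_cells_def)

lemma region_half_at: "region (half_at i) = half_cells {i}"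
  by (simp add: half_cells_def half_cell_def)

lemma region_fence_at: "region (fence_at i) = half_cells {i, i + 2}"
  by (auto simp: half_cells_def half_cell_def field_simps)

lemma slots_half_at [simp]: "slots (half_at i) = {i}"
  unfolding slots_def region_half_at by simp

lemma slots_fence_at [simp]: "slots (fence_at i) = {i, i + 2}"
  unfolding slots_def region_fence_at by auto

lemma region_grid: "grid t \<Longrightarrow> region t = half_cells (slots t)"
  unfolding grid_def using region_half_at region_fence_at by auto

lemma finite_slots: "grid t \<Longrightarrow> finite (slots t)"
  by (auto simp: grid_def)

lemma slots_nonempty: "grid t \<Longrightarrow> slots t \<noteq> {}"
  by (auto simp: grid_def)

text \<open>Distinct half-cells meet in at most an endpoint, so disjoint finite index sets give
  regions with a finite intersection, which has empty interior. Conversely, the midpoint of a shared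
  half-cell is interior to both regions.\<close>

lemma interior_half_cells_disjoint:
  assumes "finite I" "finite J"
  shows "interior (half_cells I) \<inter> interior (half_cells J) = {} \<longleftrightarrow> I \<inter> J = {}"
proof
  assume "I \<inter> J = {}"
  have "half_cells I \<inter> half_cells J \<subseteq> (\<lambda>i. real i / 2) ` (I \<union> J)"
  proof
    fix x assume "x \<in> half_cells I \<inter> half_cells J"
    then obtain i j where ij: "i \<in> I" "j \<in> J" "x \<in> half_cell i" "x \<in> half_cell j"
      by (auto simp: half_cells_def)
    with \<open>I \<inter> J = {}\<close> have "i \<noteq> j" by auto
    then have "x = real i / 2 \<or> x = real j / 2"
      using ij(3,4) by (cases "i < j") (auto simp: half_cell_def)
    with ij show "x \<in> (\<lambda>i. real i / 2) ` (I \<union> J)" by auto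
  qed
  then have "finite (half_cells I \<inter> half_cells J)"
    using assms by (meson finite_UnI finite_imageI finite_subset)
  then show "interior (half_cells I) \<inter> interior (half_cells J) = {}"
    by (metis empty_interior_finite interior_Int)
next
  assume disj: "interior (half_cells I) \<inter> interior (half_cells J) = {}"
  have "midpoint_of i \<in> interior (half_cells K)" if "i \<in> K" for i K
  proof -
    have "midpoint_of i \<in> {real i / 2<..<real i / 2 + 1/2}"
      by (simp add: midpoint_of_def)
    also have "{real i / 2<..<real i / 2 + 1/2} \<subseteq> interior (half_cells K)"
      by (rule interior_maximal) (use that in \<open>auto simp: half_cells_def half_cell_def\<close>)
    finally show ?thesis .
  qed
  with disj show "I \<inter> J = {}" by blast
qed

lemma cells_eq: "cells a m = (if m = 0 then {} else {real a..real (a + m)})"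
proof (induction m)
  case 0
  show ?case by (simp add: cells_def)
next
  case (Suc m)
  have "cells a (Suc m) = cells a m \<union> {real (a + m)..real (a + m) + 1}"
    by (auto simp: cells_def lessThan_Suc)
  then show ?case using Suc.IH by auto
qed

lemma cells_half_cells: "cells a m = half_cells {2 * a..<2 * (a + m)}"
proof (induction m)
  case 0
  show ?case by (simp add: cells_def half_cells_def)
next
  case (Suc m)
  have "cells a (Suc m) = cells a m \<union> {real (a + m)..real (a + m) + 1}"
    by (auto simp: cells_def lessThan_Suc)
  moreover have "{2 * a..<2 * (a + Suc m)} =
      {2 * a..<2 * (a + m)} \<union> {2 * (a + m), Suc (2 * (a + m))}"
    by auto
  moreover have "half_cells {2 * (a + m), Suc (2 * (a + m))} =
      {real (a + m)..real (a + m) + 1}"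
    by (auto simp: half_cells_def half_cell_def field_simps)
  ultimately show ?case using Suc.IH by (auto simp: half_cells_def)
qed

section \<open>Alignment of tiles with the half-integer grid\<close>

lemma left_edge_le: "x \<in> region t \<Longrightarrow> left_edge t \<le> x"
  by (cases t) auto

lemma left_edge_interval: "{left_edge t..left_edge t + 1/2} \<subseteq> region t"
  by (cases t) auto

lemma grid_iff: "grid t \<longleftrightarrow> (\<exists>k. left_edge t = real k / 2)"
  by (cases t) (auto simp: grid_def)

text \<open>A leftmost tile off the half-integer grid would leave a gap at its left that no tile
  can fill: a tile on the grid would overlap it, and a tile off the grid would start earlier.\<close>
lemma exactly_covers_grid:
  assumes cov: "exactly_covers A (cells a m)" and "t \<in> A"
  shows "grid t"
proof (rule ccontr)
  assume "\<not> grid t"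
  define N where "N = {t \<in> A. \<not> grid t}"
  have fin: "finite N" and ne: "N \<noteq> {}"
    using cov \<open>t \<in> A\<close> \<open>\<not> grid t\<close> by (auto simp: N_def exactly_covers_def)
  define s where "s = arg_min_on left_edge N"
  have s_min: "left_edge s \<le> left_edge u" if "u \<in> N" for u
    using arg_min_least[OF fin ne that, of left_edge] by (simp add: s_def)
  have s: "s \<in> A" "\<not> grid s" using arg_min_if_finite[OF fin ne, of left_edge]
    by (auto simp: s_def N_def)
  define x where "x = left_edge s"
  have "x \<in> region s" using left_edge_interval[of s] by (auto simp: x_def)
  with s cov have "x \<in> cells a m" by (auto simp: exactly_covers_def)
  then have m: "m \<noteq> 0" and x: "real a \<le> x" "x \<le> real (a + m)"
    by (auto simp: cells_eq split: if_splits)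
  \<comment> \<open>\<open>k\<close> is the index of the half-cell in which the leftmost off-grid
    tile \<open>s\<close> begins; since \<open>s\<close> is off the grid, it begins strictly to the
    right of \<open>real k / 2\<close>.\<close>
  define k where "k = nat \<lfloor>2 * x\<rfloor>"
  have k: "real k \<le> 2 * x" "2 * x < real k + 1" and ak: "2 * a \<le> k"
    using x(1) by (auto simp: k_def le_nat_iff le_floor_iff)
  have "real k \<noteq> 2 * x" using s(2) by (metis grid_iff x_def mult.commute nonzero_eq_divide_eq zero_neq_numeral)
  with k have k': "real k < 2 * x" by simp
  \<comment> \<open>A point of half-cell \<open>k\<close> just left of \<open>s\<close>. The tile
    \<open>u\<close> covering it gives the contradiction.\<close>
  define y where "y = (real k / 2 + x) / 2"
  have y: "real k / 2 < y" "y < x" "y < real k / 2 + 1/2"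
    using k k' by (auto simp: y_def field_simps)
  have "y \<in> cells a m"
    using y x m ak k by (auto simp: cells_eq)
  then obtain u where u: "u \<in> A" "y \<in> region u"
    using cov unfolding exactly_covers_def by blast
  show False
  proof (cases "grid u")
    case False
    with u s_min[of u] left_edge_le[of y u] y show False by (auto simp: N_def x_def)
  next
    case True
    with u obtain i where i: "half_cell i \<subseteq> region u" "y \<in> half_cell i"
      by (auto simp: region_grid half_cells_def)
    have "i = k"
    proof (rule ccontr)
      assume "i \<noteq> k"
      then have "i + 1 \<le> k \<or> k + 1 \<le> i" by arith
      then have "real i + 1 \<le> real k \<or> real k + 1 \<le> real i"
        by linarith
      with i(2) y show False by (auto simp: half_cell_def)
    qed
    \<comment> \<open>A grid tile covering \<open>y\<close> contains all of half-cell
      \<open>k\<close>, and \<open>s\<close> contains the half-unit to the right of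
      \<open>x\<close>; their interiors share the rest of half-cell \<open>k\<close>.\<close>
    have "{x<..<real k / 2 + 1/2} \<subseteq> interior (region u)"
      by (rule interior_maximal) (use i k' \<open>i = k\<close> in \<open>auto simp: half_cell_def subset_iff\<close>)
    moreover have "{x<..<real k / 2 + 1/2} \<subseteq> interior (region s)"
      by (rule interior_maximal)
        (use left_edge_interval[of s] k' in \<open>auto simp: x_def subset_iff\<close>)
    moreover have "(x + (real k / 2 + 1/2)) / 2 \<in> {x<..<real k / 2 + 1/2}"
      using k by (auto simp: field_simps)
    moreover have "u \<noteq> s" using True s by auto
    ultimately show False using cov u s unfolding exactly_covers_def by blast
  qed
qed

section \<open>Exact covers as partitions of half-cell indices\<close>

text \<open>Discrete form of \<open>exactly_covers\<close>. The block is given by its two end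
  positions instead of start and length, since later arguments cut blocks at positions.\<close>

definition slot_cover :: "tile set \<Rightarrow> nat \<Rightarrow> nat \<Rightarrow> bool" where
  "slot_cover A a b \<longleftrightarrow> finite A \<and> (\<forall>t\<in>A. grid t) \<and>
     (\<forall>s\<in>A. \<forall>t\<in>A. s \<noteq> t \<longrightarrow> slots s \<inter> slots t = {}) \<and>
     (\<Union>t\<in>A. slots t) = {2 * a..<2 * b}"

lemma exactly_covers_iff: "exactly_covers A (cells a m) \<longleftrightarrow> slot_cover A a (a + m)"
proof (cases "\<forall>t\<in>A. grid t")
  case False
  then show ?thesis using exactly_covers_grid by (auto simp: slot_cover_def)
next
  case True
  then have "(\<Union>t\<in>A. region t) = half_cells (\<Union>t\<in>A. slots t)"
    by (simp add: half_cells_Union region_grid)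
  moreover have "interior (region s) \<inter> interior (region t) = {} \<longleftrightarrow> slots s \<inter> slots t = {}"
    if "s \<in> A" "t \<in> A" for s t
    using that True by (simp add: region_grid interior_half_cells_disjoint finite_slots)
  ultimately show ?thesis using True
    by (simp add: exactly_covers_def slot_cover_def cells_half_cells half_cells_eq_iff)
qed

lemma tiling_iff: "tiling n A \<longleftrightarrow> slot_cover A 0 n"
  using exactly_covers_iff[of A 0 n] by (simp add: tiling_def board_def)

section \<open>Breaks and metatiles\<close>

text \<open>A fence with one post on each side of position \<open>c\<close> counts as crossing
  \<open>c\<close>, even where only its gap lies over that position.\<close>

definition is_break :: "tile set \<Rightarrow> nat \<Rightarrow> bool" where
  "is_break A c \<longleftrightarrow> (\<forall>t\<in>A. slots t \<subseteq> {..<2 * c} \<or> slots t \<subseteq> {2 * c..})"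

definition tiles_between :: "tile set \<Rightarrow> nat \<Rightarrow> nat \<Rightarrow> tile set" where
  "tiles_between A a b = {t \<in> A. slots t \<subseteq> {2 * a..<2 * b}}"

text \<open>A tile that meets the block crosses neither of its end positions, so it lies inside the
  block.\<close>

lemma slot_cover_tiles_between:
  assumes "slot_cover A p q" "is_break A a" "is_break A b" "p \<le> a" "a \<le> b" "b \<le> q"
  shows "slot_cover (tiles_between A a b) a b"
proof -
  have "i \<in> (\<Union>t\<in>tiles_between A a b. slots t)" if i: "i \<in> {2 * a..<2 * b}" for i
  proof -
    have "i \<in> {2 * p..<2 * q}" using i assms by auto
    then obtain t where t: "t \<in> A" "i \<in> slots t"
      using assms(1) unfolding slot_cover_def by blast
    then have "slots t \<subseteq> {2 * a..}" "slots t \<subseteq> {..<2 * b}"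
      using assms(2,3) i by (fastforce simp: is_break_def)+
    then have "slots t \<subseteq> {2 * a..<2 * b}" by (auto simp: subset_iff)
    with t show ?thesis by (auto simp: tiles_between_def)
  qed
  then have "(\<Union>t\<in>tiles_between A a b. slots t) = {2 * a..<2 * b}"
    by (auto simp: tiles_between_def)
  with assms(1) show ?thesis by (auto simp: slot_cover_def tiles_between_def)
qed

text \<open>Each tile of \<open>A\<close> inside the block shares a half-cell with some tile of
  \<open>B\<close>, and disjointness within \<open>A\<close> makes the two equal.\<close>

lemma slot_cover_subset_tiles_between:
  assumes "slot_cover A p q" "B \<subseteq> A" "slot_cover B a b"
  shows "B = tiles_between A a b"
proof
  show "B \<subseteq> tiles_between A a b"
    using assms by (auto simp: slot_cover_def tiles_between_def)
  show "tiles_between A a b \<subseteq> B"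
  proof
    fix t assume t: "t \<in> tiles_between A a b"
    then have "t \<in> A" "grid t" using assms(1) by (auto simp: tiles_between_def slot_cover_def)
    then obtain i where i: "i \<in> slots t" using slots_nonempty by blast
    with t have "i \<in> {2 * a..<2 * b}" by (auto simp: tiles_between_def)
    then obtain s where "s \<in> B" "i \<in> slots s"
      using assms(3) unfolding slot_cover_def by blast
    moreover have "s = t"
      using assms(1,2) i \<open>t \<in> A\<close> \<open>s \<in> B\<close> \<open>i \<in> slots s\<close> unfolding slot_cover_def by blast
    ultimately show "t \<in> B" by simp
  qed
qed

text \<open>A fence cannot straddle a nonempty block of cells, since its gap is half a cell wide.\<close>
lemma slot_cover_subset_breaks:
  assumes "slot_cover A p q" "B \<subseteq> A" "slot_cover B a b" "a < b"
  shows "is_break A a" "is_break A b" "p \<le> a" "b \<le> q"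
proof -
  have *: "slots t \<subseteq> {..<2 * a} \<or> slots t \<subseteq> {2 * a..<2 * b} \<or> slots t \<subseteq> {2 * b..}" if "t \<in> A" for t
  proof (cases "t \<in> B")
    case True
    then show ?thesis using assms(3) by (auto simp: slot_cover_def)
  next
    case False
    have "slots t \<inter> slots s = {}" if "s \<in> B" for s
    proof -
      have "s \<in> A" "t \<noteq> s" using that False assms(2) by auto
      with assms(1) \<open>t \<in> A\<close> show ?thesis by (simp add: slot_cover_def)
    qed
    then have "slots t \<inter> (\<Union>s\<in>B. slots s) = {}" by auto
    then have "slots t \<inter> {2 * a..<2 * b} = {}"
      using assms(3) by (simp add: slot_cover_def)
    moreover have "grid t" using assms(1) \<open>t \<in> A\<close> by (simp add: slot_cover_def)
    then obtain i where "t = half_at i \<or> t = fence_at i"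
      unfolding grid_def by blast
    then have "slots t = {i} \<or> slots t = {i, i + 2}" by auto
    \<comment> \<open>If the left post of a fence has \<open>i < 2 * a\<close>, then
      \<open>i + 2 < 2 * a + 2 \<le> 2 * b\<close>, so the right post cannot lie beyond the
      block.\<close>
    ultimately show ?thesis using \<open>a < b\<close> by auto
  qed
  have "{2 * a..<2 * b} \<subseteq> {2 * a..}" "{2 * a..<2 * b} \<subseteq> {..<2 * b}"
    "{..<2 * a} \<subseteq> {..<2 * b}" "{2 * b..} \<subseteq> {2 * a..}"
    using \<open>a < b\<close> by auto
  then show "is_break A a" "is_break A b"
    unfolding is_break_def using * by (meson order_trans)+
  have "(\<Union>s\<in>B. slots s) \<subseteq> (\<Union>s\<in>A. slots s)"
    using assms(2) by auto
  then have "{2 * a..<2 * b} \<subseteq> {2 * p..<2 * q}"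
    using assms(1,3) by (simp add: slot_cover_def)
  with \<open>a < b\<close> show "p \<le> a" "b \<le> q"
    by auto
qed

lemma slot_cover_empty_iff: "slot_cover A a b \<Longrightarrow> A = {} \<longleftrightarrow> b \<le> a"
  using slots_nonempty by (fastforce simp: slot_cover_def)

lemma slot_cover_unique:
  assumes "slot_cover A a b" "slot_cover A a c" "a < b" "a < c"
  shows "b = c"
proof -
  have "{2 * a..<2 * b} = {2 * a..<2 * c}" using assms(1,2) by (simp add: slot_cover_def)
  with assms(3,4) show ?thesis by (auto simp: atLeastLessThan_eq_iff)
qed

text \<open>The metatiles inside a tiling are the sets of tiles between consecutive breaks:
  minimality of an exactly covering subset amounts to the absence of a break strictly
  inside.\<close>

lemma even_metatile_iff_breaks:
  assumes A: "slot_cover A 0 n"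
  shows "(\<exists>M m. M \<subseteq> A \<and> metatile m M \<and> even m) \<longleftrightarrow>
    (\<exists>a b. a < b \<and> b \<le> n \<and> even (b - a) \<and> is_break A a \<and> is_break A b \<and>
      (\<forall>c. a < c \<and> c < b \<longrightarrow> \<not> is_break A c))"
proof (intro iffI; elim exE conjE)
  fix M m assume M: "M \<subseteq> A" "metatile m M" "even m"
  then obtain a where cov: "slot_cover M a (a + m)" and "M \<noteq> {}"
    by (auto simp: metatile_def exactly_covers_iff)
  then have "a < a + m" using slot_cover_empty_iff[OF cov] by simp
  note br = slot_cover_subset_breaks[OF A M(1) cov this]
  have "\<not> is_break A c" if c: "a < c" "c < a + m" for c
  proof
    assume "is_break A c"
    \<comment> \<open>Cutting \<open>M\<close> at an interior break leaves a nonempty proper subset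
      that again covers whole cells.\<close>
    then have B: "slot_cover (tiles_between A a c) a c"
      using c br by (intro slot_cover_tiles_between[OF A]) auto
    then have "exactly_covers (tiles_between A a c) (cells a (c - a))"
      using c by (simp add: exactly_covers_iff)
    moreover have "tiles_between A a c \<noteq> {}"
      using slot_cover_empty_iff[OF B] c by simp
    moreover have "tiles_between A a c \<subseteq> M"
      using c unfolding slot_cover_subset_tiles_between[OF A M(1) cov]
      by (fastforce simp: tiles_between_def)
    moreover have "tiles_between A a c \<noteq> M"
      using slot_cover_unique[of M a c "a + m"] B cov c by auto
    ultimately show False using M(2) unfolding metatile_def by blast
  qed
  with br \<open>a < a + m\<close> M(3) show "\<exists>a b. a < b \<and> b \<le> n \<and> even (b - a) \<and>
      is_break A a \<and> is_break A b \<and> (\<forall>c. a < c \<and> c < b \<longrightarrow> \<not> is_break A c)"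
    by (intro exI[of _ a] exI[of _ "a + m"]) auto
next
  fix a b
  assume ab: "a < b" "b \<le> n" "even (b - a)" "is_break A a" "is_break A b"
    and no_break: "\<forall>c. a < c \<and> c < b \<longrightarrow> \<not> is_break A c"
  define M where "M = tiles_between A a b"
  have M: "slot_cover M a b"
    unfolding M_def using ab by (intro slot_cover_tiles_between[OF A]) auto
  have "M \<subseteq> A" by (auto simp: M_def tiles_between_def)
  have "\<not> exactly_covers B (cells c k)" if B: "B \<subset> M" "B \<noteq> {}" for B c k
  proof
    assume "exactly_covers B (cells c k)"
    then have cov: "slot_cover B c (c + k)" by (simp add: exactly_covers_iff)
    have "c < c + k" using slot_cover_empty_iff[OF cov] B by auto
    have "B \<subseteq> A" "B \<subseteq> M" using B \<open>M \<subseteq> A\<close> by auto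
    have "is_break A c" "is_break A (c + k)" "a \<le> c" "c + k \<le> b"
      using slot_cover_subset_breaks[OF A \<open>B \<subseteq> A\<close> cov \<open>c < c + k\<close>]
        slot_cover_subset_breaks[OF M \<open>B \<subseteq> M\<close> cov \<open>c < c + k\<close>] by auto
    \<comment> \<open>Both ends of the block covered by \<open>B\<close> are breaks between
      \<open>a\<close> and \<open>b\<close>, hence equal to these ends.\<close>
    with no_break \<open>c < c + k\<close> have "c = a" "c + k = b"
      by (metis le_neq_implies_less less_le_trans order_le_less_trans)+
    with slot_cover_subset_tiles_between[OF A \<open>B \<subseteq> A\<close> cov] B show False
      by (simp add: M_def)
  qed
  then have "metatile (b - a) M"
    unfolding metatile_def using slot_cover_empty_iff[OF M] M ab(1)
    by (auto simp: exactly_covers_iff intro!: exI[of _ a])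
  with \<open>M \<subseteq> A\<close> ab(3) show "\<exists>M m. M \<subseteq> A \<and> metatile m M \<and> even m" by blast
qed

section \<open>Tilings determined by their fences\<close>

definition fences :: "tile set \<Rightarrow> nat set" where
  "fences A = {i. fence_at i \<in> A}"

text \<open>The right post must stay on the board, and two different fences share a half-cell only
  if their starts differ by 2.\<close>

definition fence_set :: "nat \<Rightarrow> nat set \<Rightarrow> bool" where
  "fence_set n F \<longleftrightarrow> (\<forall>i\<in>F. i + 2 < 2 * n \<and> i + 2 \<notin> F)"

definition tiles_of :: "nat \<Rightarrow> nat set \<Rightarrow> tile set" where
  "tiles_of n F = fence_at ` F \<union> half_at ` ({..<2 * n} - F - (\<lambda>i. i + 2) ` F)"

lemma fences_tiles_of [simp]: "fences (tiles_of n F) = F"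
  by (auto simp: fences_def tiles_of_def)

lemma slot_cover_tiles_of:
  assumes "fence_set n F"
  shows "slot_cover (tiles_of n F) 0 n"
proof -
  have "F \<subseteq> {..<2 * n}" using assms by (auto simp: fence_set_def)
  then have "finite F" by (rule finite_subset) simp
  moreover have "(\<Union>t\<in>tiles_of n F. slots t) = {..<2 * n}"
  proof
    show "(\<Union>t\<in>tiles_of n F. slots t) \<subseteq> {..<2 * n}"
      using assms \<open>F \<subseteq> {..<2 * n}\<close> by (auto simp: tiles_of_def fence_set_def)
    show "{..<2 * n} \<subseteq> (\<Union>t\<in>tiles_of n F. slots t)"
      by (auto simp: tiles_of_def)
  qed
  moreover have "slots s \<inter> slots t = {}"
    if "s \<in> tiles_of n F" "t \<in> tiles_of n F" "s \<noteq> t" for s t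
    using that assms by (auto simp: tiles_of_def fence_set_def)
  ultimately show ?thesis
    unfolding slot_cover_def by (auto simp: tiles_of_def grid_def lessThan_atLeast0)
qed

text \<open>The half-squares occupy precisely the half-cells without a post, so the fences determine
  the tiling.\<close>

lemma slot_cover_fences:
  assumes "slot_cover A 0 n"
  shows "fence_set n (fences A)" "tiles_of n (fences A) = A"
proof -
  have disj: "s = t" if "s \<in> A" "t \<in> A" "i \<in> slots s" "i \<in> slots t" for s t i
    using assms that unfolding slot_cover_def by blast
  have un: "(\<Union>t\<in>A. slots t) = {..<2 * n}" and grid: "\<And>t. t \<in> A \<Longrightarrow> grid t"
    using assms by (auto simp: slot_cover_def)
  have range: "i < 2 * n" if "t \<in> A" "i \<in> slots t" for t i
    using un that by blast
  show "fence_set n (fences A)"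
    unfolding fence_set_def
  proof (intro ballI conjI)
    fix i assume i: "i \<in> fences A"
    then show "i + 2 < 2 * n" by (auto simp: fences_def intro: range)
    show "i + 2 \<notin> fences A"
      using i disj[of "fence_at i" "fence_at (i + 2)" "i + 2"]
      unfolding fences_def mem_Collect_eq slots_fence_at by fastforce
  qed
  have "half_at i \<in> A \<longleftrightarrow> i \<in> {..<2 * n} - fences A - (\<lambda>i. i + 2) ` fences A" for i
  proof
    assume i: "half_at i \<in> A"
    have "fence_at j \<notin> A" if "i = j \<or> i = j + 2" for j
      using disj[of "half_at i" "fence_at j" i] i that by auto
    with range[OF i] show "i \<in> {..<2 * n} - fences A - (\<lambda>i. i + 2) ` fences A"
      by (auto simp: fences_def)
  next
    assume i: "i \<in> {..<2 * n} - fences A - (\<lambda>i. i + 2) ` fences A"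
    then obtain t where t: "t \<in> A" "i \<in> slots t" using un by blast
    obtain j where "t = half_at j \<or> t = fence_at j" using grid[OF t(1)] by (auto simp: grid_def)
    with t i show "half_at i \<in> A" by (auto simp: fences_def)
  qed
  then have "t \<in> tiles_of n (fences A) \<longleftrightarrow> t \<in> A" if "grid t" for t
    using that by (auto simp: grid_def tiles_of_def fences_def)
  moreover have "grid t" if "t \<in> tiles_of n (fences A)" for t
    using that by (auto simp: grid_def tiles_of_def)
  ultimately show "tiles_of n (fences A) = A" using grid by blast
qed

lemma is_break_iff_fences:
  assumes "slot_cover A 0 n"
  shows "is_break A c \<longleftrightarrow> (\<forall>i\<in>fences A. i + 2 < 2 * c \<or> 2 * c \<le> i)"
proof -
  have "is_break A c \<longleftrightarrow> is_break (tiles_of n (fences A)) c"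
    using slot_cover_fences(2)[OF assms] by simp
  also have "\<dots> \<longleftrightarrow> (\<forall>i\<in>fences A. i + 2 < 2 * c \<or> 2 * c \<le> i)"
    unfolding is_break_def tiles_of_def by (auto simp: ball_Un)
  finally show ?thesis .
qed

section \<open>Words of letters and their blocks\<close>

type_synonym letter = "bool \<times> bool"

abbreviation gap :: letter where
  "gap \<equiv> (False, False)"

text \<open>\<open>x\<close> is the letter of the preceding cell. A fence puts its right post into
  the same half of the next cell, which excludes a fence starting there; a fence starting in the
  last cell would protrude.\<close>

fun linked :: "letter \<Rightarrow> letter list \<Rightarrow> bool" where
  "linked x [] \<longleftrightarrow> x = gap"
| "linked x (y # w) \<longleftrightarrow> \<not> (fst x \<and> fst y) \<and> \<not> (snd x \<and> snd y) \<and> linked y w"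

text \<open>The letters \<open>u\<close> together with the closing \<open>gap\<close> form the
  block, so odd length of \<open>u\<close> means a metatile of even length.\<close>

definition even_block :: "letter list \<Rightarrow> bool" where
  "even_block v \<longleftrightarrow>
     (\<exists>p u q. v = p @ gap # u @ gap # q \<and> gap \<notin> set u \<and> odd (length u))"

text \<open>\<open>x\<close> only restricts the first letter, while blocks are counted from the
  prepended \<open>gap\<close>. This fits the deletion of nonzero letters in pairs: the last deleted
  letter still constrains its successor, but the parity starts afresh.\<close>

definition words :: "letter \<Rightarrow> nat \<Rightarrow> letter list set" where
  "words x n = {w. length w = n \<and> linked x w \<and> \<not> even_block (gap # w)}"

definition word_of :: "nat \<Rightarrow> nat set \<Rightarrow> letter list" where
  "word_of n F = map (\<lambda>c. (2 * c \<in> F, 2 * c + 1 \<in> F)) [0..<n]"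

lemma linked_iff_nth:
  "linked x w \<longleftrightarrow> last (x # w) = gap \<and>
     (\<forall>i<length w. \<not> (fst ((x # w) ! i) \<and> fst (w ! i)) \<and> \<not> (snd ((x # w) ! i) \<and> snd (w ! i)))"
  by (induction x w rule: linked.induct) (auto simp: All_less_Suc2)

lemma even_block_iff_nth:
  "even_block v \<longleftrightarrow> (\<exists>a b. a < b \<and> b < length v \<and> even (b - a) \<and> v ! a = gap \<and> v ! b = gap \<and>
     (\<forall>c. a < c \<and> c < b \<longrightarrow> v ! c \<noteq> gap))"
proof
  assume "even_block v"
  then obtain p u q where v: "v = p @ gap # u @ gap # q" "gap \<notin> set u" "odd (length u)"
    unfolding even_block_def by blast
  show "\<exists>a b. a < b \<and> b < length v \<and> even (b - a) \<and> v ! a = gap \<and> v ! b = gap \<and>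
     (\<forall>c. a < c \<and> c < b \<longrightarrow> v ! c \<noteq> gap)"
  proof (intro exI conjI allI impI; (elim conjE)?)
    fix c assume c: "length p < c" "c < Suc (length p + length u)"
    then obtain d where "c = Suc (length p + d)" "d < length u"
      by (metis add_Suc_right add_less_cancel_left less_iff_Suc_add plus_nat.simps(2) Suc_less_eq)
    then have "v ! c = u ! d" by (simp add: v(1) nth_append)
    with \<open>d < length u\<close> v(2) show "v ! c \<noteq> gap" by (metis nth_mem)
  qed (use v in \<open>auto simp: nth_append\<close>)
next
  assume "\<exists>a b. a < b \<and> b < length v \<and> even (b - a) \<and> v ! a = gap \<and> v ! b = gap \<and>
     (\<forall>c. a < c \<and> c < b \<longrightarrow> v ! c \<noteq> gap)"
  then obtain a b where ab: "a < b" "b < length v" "even (b - a)" "v ! a = gap" "v ! b = gap"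
    and no_gap: "\<forall>c. a < c \<and> c < b \<longrightarrow> v ! c \<noteq> gap" by blast
  define u where "u = take (b - Suc a) (drop (Suc a) v)"
  have u: "length u = b - Suc a" using ab by (simp add: u_def)
  have "drop (Suc a) v = u @ drop b v"
    using ab append_take_drop_id[of "b - Suc a" "drop (Suc a) v"] by (simp add: u_def)
  also have "drop b v = gap # drop (Suc b) v"
    using ab by (metis Cons_nth_drop_Suc)
  finally have "v = take a v @ gap # u @ gap # drop (Suc b) v"
    using ab by (metis id_take_nth_drop order.strict_trans)
  moreover have "gap \<notin> set u"
    using no_gap u ab by (auto simp: in_set_conv_nth u_def)
  moreover have "odd (length u)" using ab u by (simp add: even_Suc Suc_diff_Suc[symmetric])
  ultimately show "even_block v" unfolding even_block_def by blast
qed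

text \<open>An even block cannot open at the first \<open>gap\<close>, because \<open>u\<close> has
  odd length and would have to begin with the second \<open>gap\<close>.\<close>

lemma even_block_Cons_gap [simp]: "even_block (gap # gap # w) \<longleftrightarrow> even_block (gap # w)"
proof
  assume "even_block (gap # gap # w)"
  then obtain p u q where *: "gap # gap # w = p @ gap # u @ gap # q" "gap \<notin> set u" "odd (length u)"
    unfolding even_block_def by blast
  then obtain p' where "p = gap # p'" by (cases p; cases u) auto
  with * show "even_block (gap # w)" unfolding even_block_def by auto
next
  assume "even_block (gap # w)"
  then obtain p u q where "gap # w = p @ gap # u @ gap # q" "gap \<notin> set u" "odd (length u)"
    unfolding even_block_def by blast
  then have "gap # gap # w = (gap # p) @ gap # u @ gap # q" "gap \<notin> set u" "odd (length u)"
    by auto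
  then show "even_block (gap # gap # w)" unfolding even_block_def by blast
qed

lemma even_block_singleton:
  assumes "x \<noteq> gap"
  shows "even_block (gap # x # gap # w)"
proof -
  have "gap # x # gap # w = [] @ gap # [x] @ gap # w" "gap \<notin> set [x]" "odd (length [x])"
    using assms by auto
  then show ?thesis unfolding even_block_def by blast
qed

lemma even_block_drop_two:
  assumes "x \<noteq> gap" "y \<noteq> gap"
  shows "even_block (gap # x # y # w) \<longleftrightarrow> even_block (gap # w)"
proof
  assume "even_block (gap # x # y # w)"
  then obtain p u q where *: "gap # x # y # w = p @ gap # u @ gap # q" "gap \<notin> set u" "odd (length u)"
    unfolding even_block_def by blast
  show "even_block (gap # w)"
  proof (cases p)
    case Nil
    \<comment> \<open>The block opens at the first \<open>gap\<close>; as \<open>x\<close> and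
      \<open>y\<close> are nonzero, it closes only after them.\<close>
    with * assms obtain u' where "u = x # y # u'"
      by (cases u; cases "tl u") auto
    with * Nil have "gap # w = [] @ gap # u' @ gap # q" "gap \<notin> set u'" "odd (length u')"
      by auto
    then show ?thesis unfolding even_block_def by blast
  next
    case (Cons a p')
    with * assms obtain p'' where "p' = x # y # p''"
      by (cases p'; cases "tl p'") auto
    with * Cons have "gap # w = (gap # p'') @ gap # u @ gap # q" by auto
    with * show ?thesis unfolding even_block_def by blast
  qed
next
  assume "even_block (gap # w)"
  then obtain p u q where *: "gap # w = p @ gap # u @ gap # q" "gap \<notin> set u" "odd (length u)"
    unfolding even_block_def by blast
  show "even_block (gap # x # y # w)"
  proof (cases p)
    case Nil
    with * assms have "gap # x # y # w = [] @ gap # (x # y # u) @ gap # q"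
      "gap \<notin> set (x # y # u)" "odd (length (x # y # u))"
      by auto
    then show ?thesis unfolding even_block_def by blast
  next
    case (Cons a p')
    with * have "gap # x # y # w = (gap # x # y # p') @ gap # u @ gap # q" by auto
    with * show ?thesis unfolding even_block_def by blast
  qed
qed

lemma not_even_block_gap [simp]: "\<not> even_block [gap]"
  by (auto simp: even_block_def Cons_eq_append_conv)

section \<open>Counting words without even blocks\<close>

lemma words_0: "words x 0 = (if x = gap then {[]} else {})"
  by (auto simp: words_def)

lemma words_1: "words x 1 = {[gap]}"
  by (auto simp: words_def length_Suc_conv)

text \<open>A nonzero first letter followed by \<open>gap\<close> is an even block, so the second
  letter is nonzero too. Linking then makes the two letters complementary, and the pair can be
  deleted, leaving its second letter as the link.\<close>

lemma words_gap_Suc_Suc: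
  "words gap (Suc (Suc n)) = (#) gap ` words gap (Suc n) \<union>
     ((\<lambda>w. (True, False) # (False, True) # w) ` words (False, True) n \<union>
      (\<lambda>w. (False, True) # (True, False) # w) ` words (True, False) n)" (is "?L = ?R")
proof (rule set_eqI)
  fix v :: "letter list"
  consider "length v < 2" | p q r s w where "v = (p, q) # (r, s) # w"
    by (cases v; cases "tl v") auto
  then show "v \<in> ?L \<longleftrightarrow> v \<in> ?R"
  proof cases
    case 2
    show ?thesis unfolding 2
      by (cases p; cases q; cases r; cases s)
        (auto simp: words_def image_iff even_block_drop_two even_block_singleton)
  qed (auto simp: words_def)
qed

text \<open>Linking leaves only \<open>gap\<close> or the complementary letter in first place. In
  the latter case the second letter is again nonzero, so it equals the original link.\<close>

lemma words_Suc_Suc: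
  "words (b, \<not> b) (Suc (Suc n)) = (#) gap ` words gap (Suc n) \<union>
     (\<lambda>w. (\<not> b, b) # (b, \<not> b) # w) ` words (b, \<not> b) n" (is "?L = ?R")
proof (rule set_eqI)
  fix v :: "letter list"
  consider "length v < 2" | p q r s w where "v = (p, q) # (r, s) # w"
    by (cases v; cases "tl v") auto
  then show "v \<in> ?L \<longleftrightarrow> v \<in> ?R"
  proof cases
    case 2
    show ?thesis unfolding 2
      by (cases b; cases p; cases q; cases r; cases s)
        (auto simp: words_def image_iff even_block_drop_two even_block_singleton)
  qed (auto simp: words_def)
qed

lemma finite_words [simp]: "finite (words x n)"
proof (rule finite_subset)
  show "words x n \<subseteq> {w. set w \<subseteq> UNIV \<and> length w = n}" by (auto simp: words_def)
qed (rule finite_lists_length_eq, simp)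

lemma card_words_Suc_Suc:
  "card (words (b, \<not> b) (Suc (Suc n))) = card (words gap (Suc n)) + card (words (b, \<not> b) n)"
proof -
  have "card (words (b, \<not> b) (Suc (Suc n))) = card ((#) gap ` words gap (Suc n)) +
      card ((\<lambda>w. (\<not> b, b) # (b, \<not> b) # w) ` words (b, \<not> b) n)"
    unfolding words_Suc_Suc by (rule card_Un_disjoint) auto
  then show ?thesis by (simp add: card_image inj_on_def)
qed

text \<open>Both counts have initial values 0 and 1 and obey the same recurrence.\<close>

lemma card_words_swap: "card (words (True, False) n) = card (words (False, True) n)"
  using card_words_Suc_Suc[of True] card_words_Suc_Suc[of False]
  by (induction n rule: induct_nat_012) (simp_all add: words_0 words_1[unfolded One_nat_def])

lemma card_words_gap_Suc_Suc:
  "card (words gap (Suc (Suc n))) = card (words gap (Suc n)) + 2 * card (words (True, False) n)"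
proof -
  have "card (words gap (Suc (Suc n))) = card ((#) gap ` words gap (Suc n)) +
      (card ((\<lambda>w. (True, False) # (False, True) # w) ` words (False, True) n) +
       card ((\<lambda>w. (False, True) # (True, False) # w) ` words (True, False) n))"
    unfolding words_gap_Suc_Suc by (subst card_Un_disjoint; (subst card_Un_disjoint)?; auto)
  then show ?thesis by (simp add: card_image inj_on_def card_words_swap)
qed

text \<open>Write \<open>a n\<close> and \<open>b n\<close> for the counts with link
  \<open>gap\<close> and \<open>(True, False)\<close>. Then \<open>2 * b (n + 2) = 2 * a (n + 1) + 2
  * b n = a (n + 1) + a (n + 2)\<close>, which eliminates \<open>b\<close> from the recurrence for
  \<open>a\<close>.\<close>

lemma card_words_linked_block:
  "2 * card (words (True, False) (Suc n)) = card (words gap (Suc n)) + card (words gap n)"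
proof (induction n)
  case 0
  show ?case by (simp add: words_0 words_1[unfolded One_nat_def])
next
  case (Suc n)
  show ?case using card_words_Suc_Suc[of True n] card_words_gap_Suc_Suc[of n] by simp
qed

lemma card_words_gap_tribonacci:
  "card (words gap (n + 3)) = card (words gap (n + 2)) + card (words gap (n + 1)) + card (words gap n)"
  using card_words_gap_Suc_Suc[of "Suc n"] card_words_linked_block[of n]
  by (simp add: numeral_eq_Suc)

lemma card_words_gap_init:
  "card (words gap 0) = 1" "card (words gap 1) = 1" "card (words gap 2) = 1"
  using card_words_gap_Suc_Suc[of 0] by (simp_all add: words_0 words_1 words_1[unfolded One_nat_def] numeral_2_eq_2)

section \<open>The bijection between tilings and words\<close>

lemma length_word_of [simp]: "length (word_of n F) = n"
  by (simp add: word_of_def)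

lemma word_of_inj:
  assumes "F \<subseteq> {..<2 * n}" "G \<subseteq> {..<2 * n}" "word_of n F = word_of n G"
  shows "F = G"
proof -
  have *: "2 * c \<in> F \<longleftrightarrow> 2 * c \<in> G" "2 * c + 1 \<in> F \<longleftrightarrow> 2 * c + 1 \<in> G" if "c < n" for c
    using assms(3) that by (auto simp: word_of_def)
  have "i \<in> F \<longleftrightarrow> i \<in> G" if "i < 2 * n" for i
    using *[of "i div 2"] that by (cases "even i") auto
  with assms(1,2) show ?thesis by auto
qed

lemma word_of_surj: "\<exists>F \<subseteq> {..<2 * length w}. word_of (length w) F = w"
proof (intro exI conjI)
  let ?F = "{i. i < 2 * length w \<and> (if even i then fst else snd) (w ! (i div 2))}"
  show "word_of (length w) ?F = w"
    by (rule nth_equalityI) (auto simp: word_of_def prod_eq_iff)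
qed auto

text \<open>A fence crosses position \<open>c\<close> iff it starts in cell \<open>c - 1\<close>,
  whose letter has index \<open>c\<close> once \<open>gap\<close> is prepended. The prepended letter
  itself reflects that position 0 is always a break.\<close>

lemma gap_word_of_nth:
  assumes "c \<le> n"
  shows "(gap # word_of n F) ! c = gap \<longleftrightarrow> (\<forall>i\<in>F. i + 2 < 2 * c \<or> 2 * c \<le> i)"
proof (cases c)
  case (Suc d)
  have "(\<forall>i\<in>F. i + 2 < 2 * c \<or> 2 * c \<le> i) \<longleftrightarrow> 2 * d \<notin> F \<and> 2 * d + 1 \<notin> F"
  proof -
    have "\<not> (i + 2 < 2 * c \<or> 2 * c \<le> i) \<longleftrightarrow> i = 2 * d \<or> i = 2 * d + 1" for i
      using Suc by auto
    then show ?thesis by metis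
  qed
  with Suc assms show ?thesis by (auto simp: word_of_def)
qed simp

lemma linked_word_of_iff:
  assumes "F \<subseteq> {..<2 * n}"
  shows "linked gap (word_of n F) \<longleftrightarrow> fence_set n F"
proof -
  have pairs: "(\<forall>i<n. \<not> (fst ((gap # word_of n F) ! i) \<and> fst (word_of n F ! i)) \<and>
      \<not> (snd ((gap # word_of n F) ! i) \<and> snd (word_of n F ! i))) \<longleftrightarrow> (\<forall>i. i + 2 \<in> F \<longrightarrow> i \<notin> F)"
    (is "?P \<longleftrightarrow> ?Q")
  proof
    assume ?P
    show ?Q
    proof (intro allI impI)
      fix i assume "i + 2 \<in> F"
      then have "i + 2 < 2 * n" using assms by auto
      define d where "d = i div 2"
      have i: "i = 2 * d \<or> i = 2 * d + 1" unfolding d_def by presburger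
      then have "Suc d < n" using \<open>i + 2 < 2 * n\<close> by auto
      with \<open>?P\<close> have "\<not> (2 * d \<in> F \<and> 2 * d + 2 \<in> F)" "\<not> (2 * d + 1 \<in> F \<and> 2 * d + 1 + 2 \<in> F)"
        by (auto simp: word_of_def numeral_eq_Suc dest!: spec[of _ "Suc d"])
      with i \<open>i + 2 \<in> F\<close> show "i \<notin> F" by metis
    qed
  next
    assume Q: ?Q
    show ?P
    proof (intro allI impI)
      fix i assume "i < n"
      with Q show "\<not> (fst ((gap # word_of n F) ! i) \<and> fst (word_of n F ! i)) \<and>
          \<not> (snd ((gap # word_of n F) ! i) \<and> snd (word_of n F ! i))"
        by (cases i) (auto simp: word_of_def numeral_eq_Suc)
    qed
  qed
  \<comment> \<open>The condition on the last letter thus says that no fence crosses the right end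
    of the board.\<close>
  have "last (gap # word_of n F) = (gap # word_of n F) ! n"
    by (metis diff_Suc_1 last_conv_nth length_Cons length_word_of list.distinct(1))
  then have "linked gap (word_of n F) \<longleftrightarrow> (\<forall>i\<in>F. i + 2 < 2 * n \<or> 2 * n \<le> i) \<and> (\<forall>i. i + 2 \<in> F \<longrightarrow> i \<notin> F)"
    using pairs gap_word_of_nth[of n n F] by (simp only: linked_iff_nth length_word_of)
  also have "\<dots> \<longleftrightarrow> fence_set n F"
    using assms by (fastforce simp: fence_set_def)
  finally show ?thesis .
qed

lemma fence_set_subset: "fence_set n F \<Longrightarrow> F \<subseteq> {..<2 * n}"
  by (auto simp: fence_set_def)

text \<open>Breaks of the tiling and zeros of the prefixed word have the same positions, so both
  sides assert consecutive ones at even distance.\<close>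

lemma even_metatile_iff_even_block:
  assumes "slot_cover A 0 n"
  shows "(\<exists>M m. M \<subseteq> A \<and> metatile m M \<and> even m) \<longleftrightarrow> even_block (gap # word_of n (fences A))"
proof -
  have "is_break A c \<longleftrightarrow> (gap # word_of n (fences A)) ! c = gap" if "c \<le> n" for c
    using is_break_iff_fences[OF assms] gap_word_of_nth[OF that] by simp
  then show ?thesis
    unfolding even_metatile_iff_breaks[OF assms] even_block_iff_nth
    by (intro ex_cong1) (auto simp: less_Suc_eq_le)
qed

lemma T_eq_card_words: "T n = card (words gap n)"
proof -
  let ?S = "{A. tiling n A \<and> \<not> (\<exists>M m. M \<subseteq> A \<and> metatile m M \<and> even m)}"
  have "bij_betw (\<lambda>A. word_of n (fences A)) ?S (words gap n)"
    unfolding bij_betw_def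
  proof
    show "inj_on (\<lambda>A. word_of n (fences A)) ?S"
    proof (rule inj_onI)
      fix A B assume "A \<in> ?S" "B \<in> ?S" and eq: "word_of n (fences A) = word_of n (fences B)"
      then have "slot_cover A 0 n" "slot_cover B 0 n" by (auto simp: tiling_iff)
      note AB = slot_cover_fences[OF this(1)] slot_cover_fences[OF this(2)]
      then have "fences A = fences B"
        using word_of_inj[OF _ _ eq] fence_set_subset by blast
      with AB show "A = B" by metis
    qed
    show "(\<lambda>A. word_of n (fences A)) ` ?S = words gap n"
    proof (intro equalityI subsetI)
      fix w assume "w \<in> (\<lambda>A. word_of n (fences A)) ` ?S"
      then obtain A where A: "A \<in> ?S" and w: "w = word_of n (fences A)" by auto
      then have cov: "slot_cover A 0 n" by (auto simp: tiling_iff)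
      note F = slot_cover_fences(1)[OF cov]
      have "\<not> even_block (gap # w)"
        using A even_metatile_iff_even_block[OF cov] unfolding w by blast
      with linked_word_of_iff[OF fence_set_subset[OF F]] F show "w \<in> words gap n"
        by (simp add: words_def w)
    next
      fix w assume w: "w \<in> words gap n"
      then obtain F where F: "F \<subseteq> {..<2 * n}" "word_of n F = w"
        using word_of_surj[of w] by (auto simp: words_def)
      then have "fence_set n F"
        using linked_word_of_iff[OF F(1)] w by (simp add: words_def)
      note cov = slot_cover_tiles_of[OF this]
      then have "tiles_of n F \<in> ?S"
        using w F(2) even_metatile_iff_even_block[OF cov] by (simp add: tiling_iff words_def)
      moreover have "w = word_of n (fences (tiles_of n F))" using F(2) by simp
      ultimately show "w \<in> (\<lambda>A. word_of n (fences A)) ` ?S" by (rule rev_image_eqI)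
    qed
  qed
  then show ?thesis unfolding T_def by (rule bij_betw_same_card)
qed

section \<open>Fibonacci squares as a convolution\<close>

text \<open>This is \<open>g_k\<close> of the overview, taken over the integers because differences
  of its values are used.\<close>

definition even_sum :: "nat \<Rightarrow> int" where
  "even_sum k = (\<Sum>j=1..k div 2. (2 + (if j = 1 then 1 else 0)) * (int (fib (k - 2 * j + 1)))\<^sup>2)"

lemma even_sum_less_2: "k < 2 \<Longrightarrow> even_sum k = 0"
  by (simp add: even_sum_def)

text \<open>Shifting \<open>j\<close> by one adds a new first term with coefficient 3, while the
  coefficient of the former first term drops from 3 to 2.\<close>

lemma even_sum_Suc_Suc:
  assumes "k > 0"
  shows "even_sum (k + 2) = even_sum k + 3 * (int (fib (k + 1)))\<^sup>2 - (int (fib (k - 1)))\<^sup>2"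
proof -
  let ?f = "\<lambda>j. (int (fib (k - 2 * j + 1)))\<^sup>2"
  have "even_sum (k + 2) = (\<Sum>j=Suc 0..Suc (k div 2).
      (2 + (if j = 1 then 1 else 0)) * (int (fib (k + 2 - 2 * j + 1)))\<^sup>2)"
    by (simp add: even_sum_def)
  also have "\<dots> = (\<Sum>j=0..k div 2. (2 + (if j = 0 then 1 else 0)) * ?f j)"
    by (subst sum.atLeast_Suc_atMost_Suc_shift) (simp add: comp_def)
  also have "\<dots> = 3 * ?f 0 + (\<Sum>j=1..k div 2. 2 * ?f j)"
    by (subst sum.atLeast_Suc_atMost) simp_all
  also have "(\<Sum>j=1..k div 2. 2 * ?f j) = even_sum k - (int (fib (k - 1)))\<^sup>2"
  proof (cases "k < 2")
    case True
    \<comment> \<open>Here the sum is empty and the correction vanishes because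
      \<open>fib 0 = 0\<close>.\<close>
    then have "k = 1" using assms by simp
    then show ?thesis by (simp add: even_sum_def)
  next
    case False
    have "even_sum k = (\<Sum>j=1..k div 2. 2 * ?f j + (if j = 1 then ?f j else 0))"
      unfolding even_sum_def by (intro sum.cong) (auto simp: algebra_simps)
    also have "\<dots> = (\<Sum>j=1..k div 2. 2 * ?f j) + ?f 1"
      using False by (simp add: sum.distrib)
    also have "k - 2 * 1 + 1 = k - 1" using False by simp
    finally show ?thesis by simp
  qed
  finally show ?thesis by simp
qed

text \<open>Both sides agree as quadratic forms in \<open>fib n\<close> and
  \<open>fib (n + 1)\<close>. The square of \<open>fib (n + 2)\<close> is split as 1 + 3 to separate
  the tribonacci part from the increment of \<open>even_sum\<close>.\<close>

lemma fib_square_recurrence: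
  "(int (fib (n + 4)))\<^sup>2 = (int (fib (n + 3)))\<^sup>2 + (int (fib (n + 2)))\<^sup>2 + (int (fib (n + 1)))\<^sup>2
     + 3 * (int (fib (n + 2)))\<^sup>2 - (int (fib n))\<^sup>2"
  by (simp add: numeral_eq_Suc) (simp add: power2_eq_square algebra_simps)

lemma fib_square_convolution:
  fixes t :: "nat \<Rightarrow> int"
  assumes t: "t 0 = 1" "t 1 = 1" "t 2 = 1" "\<And>n. t (n + 3) = t (n + 2) + t (n + 1) + t n"
  shows "(int (fib (n + 1)))\<^sup>2 = t n + (\<Sum>k\<le>n. even_sum k * t (n - k))"
proof (induction n rule: less_induct)
  case (less n)
  let ?s = "\<lambda>n. \<Sum>k\<le>n. even_sum k * t (n - k)"
  show ?case
  proof (cases "n < 3")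
    case True
    then consider "n = 0" | "n = 1" | "n = 2" by linarith
    then show ?thesis
      using t even_sum_less_2[of 0] even_sum_less_2[of 1]
      by cases (auto simp: numeral_eq_Suc even_sum_def)
  next
    case False
    then obtain m where n: "n = m + 3" by (metis add.commute le_Suc_ex not_less)
    \<comment> \<open>The top terms of each convolution are split off so that the recurrence of
      \<open>t\<close> applies to all \<open>k \<le> m\<close>.\<close>
    have "?s (m + 3) = (\<Sum>k\<le>m. even_sum k * t (m - k + 3)) +
        even_sum (m + 1) * t 2 + even_sum (m + 2) * t 1 + even_sum (m + 3) * t 0"
      by (simp add: numeral_eq_Suc Suc_diff_le)
    moreover have "?s (m + 2) = (\<Sum>k\<le>m. even_sum k * t (m - k + 2)) +
        even_sum (m + 1) * t 1 + even_sum (m + 2) * t 0"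
      by (simp add: numeral_eq_Suc Suc_diff_le)
    moreover have "?s (m + 1) = (\<Sum>k\<le>m. even_sum k * t (m - k + 1)) + even_sum (m + 1) * t 0"
      by (simp add: Suc_diff_le)
    moreover have "(\<Sum>k\<le>m. even_sum k * t (m - k + 3)) = (\<Sum>k\<le>m. even_sum k * t (m - k + 2)) +
        (\<Sum>k\<le>m. even_sum k * t (m - k + 1)) + ?s m"
      by (simp only: t(4) sum.distrib distrib_left)
    \<comment> \<open>With \<open>t 0 = t 1 = t 2 = 1\<close>, the split-off terms contain
      \<open>even_sum (m + 1)\<close> once on the left and twice on the right, and
      \<open>even_sum (m + 2)\<close> once on each side.\<close>
    ultimately have "?s (m + 3) = ?s (m + 2) + ?s (m + 1) + ?s m + even_sum (m + 3) - even_sum (m + 1)"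
      unfolding t(1-3) by linarith
    moreover have "even_sum (m + 3) - even_sum (m + 1) = 3 * (int (fib (m + 2)))\<^sup>2 - (int (fib m))\<^sup>2"
      using even_sum_Suc_Suc[of "m + 1"] by (simp add: numeral_eq_Suc)
    moreover have "(int (fib (m + 1)))\<^sup>2 = t m + ?s m"
      "(int (fib (m + 2)))\<^sup>2 = t (m + 1) + ?s (m + 1)"
      "(int (fib (m + 3)))\<^sup>2 = t (m + 2) + ?s (m + 2)"
      using less.IH[of m] less.IH[of "m + 1"] less.IH[of "m + 2"]
      unfolding n by (simp_all add: numeral_eq_Suc)
    ultimately have "(int (fib (m + 4)))\<^sup>2 = t (m + 3) + ?s (m + 3)"
      using fib_square_recurrence[of m] t(4)[of m] by linarith
    then show ?thesis by (simp add: n numeral_eq_Suc)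
  qed
qed

theorem mainTheorem7:
  fixes n :: nat
  shows "(fib (n + 1))\<^sup>2 =
    T n + (\<Sum>k=2..n. \<Sum>j=1..k div 2.
      (2 + (if j = 1 then 1 else 0)) * (fib (k - 2 * j + 1))\<^sup>2 * T (n - k))"
proof -
  have "(int (fib (n + 1)))\<^sup>2 = int (T n) + (\<Sum>k\<le>n. even_sum k * int (T (n - k)))"
    by (rule fib_square_convolution)
      (simp_all add: T_eq_card_words card_words_gap_init[unfolded One_nat_def] card_words_gap_tribonacci[simplified])
  \<comment> \<open>The terms for \<open>k = 0\<close> and \<open>k = 1\<close> are empty
    sums.\<close>
  also have "(\<Sum>k\<le>n. even_sum k * int (T (n - k))) = (\<Sum>k=2..n. even_sum k * int (T (n - k)))"
    by (rule sum.mono_neutral_right) (auto simp: even_sum_less_2)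
  also have "\<dots> = int (\<Sum>k=2..n. \<Sum>j=1..k div 2.
      (2 + (if j = 1 then 1 else 0)) * (fib (k - 2 * j + 1))\<^sup>2 * T (n - k))"
    unfolding even_sum_def sum_distrib_right of_nat_sum by (intro sum.cong) auto
  finally have "int ((fib (n + 1))\<^sup>2) = int (T n + (\<Sum>k=2..n. \<Sum>j=1..k div 2.
      (2 + (if j = 1 then 1 else 0)) * (fib (k - 2 * j + 1))\<^sup>2 * T (n - k)))"
    by simp
  then show ?thesis by (simp only: of_nat_eq_iff)
qed

end
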